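(* Let $A_0,A_1,A_2$ be three $n\times n$ real symmetric matrices, and suppose there is $x_0\in\mathbb{R}^n$ such that $x_0^TA_1x_0<0$ and $x_0^TA_2x_0<0$. Then the following two statements are equivalent. (i) The system $$x^TA_0x<0,\qquad x^TA_1x\le0,\qquad x^TA_2x\le0$$ has no solution $x\in\mathbb{R}^n$, and Property $\mathcal{IR}$ fails for $A_0,A_1,A_2$. (ii) There exist $\mu_1^0\ge0$ and $\mu_2^0\ge0$ such that $A_0+\mu_1^0A_1+\mu_2^0A_2\succeq0$.
   Context: $M\succeq0$ means that $M$ is positive semidefinite; $I_n$ is the $n\times n$ identity matrix. Property $\mathcal{IR}$. For real symmetric $n\times n$ matrices $A_0,A_1,A_2$ (in this order), Property $\mathcal{IR}$ holds if there exist three positive real numbers $\breve\mu_1,\breve\mu_2,\breve\mu_3$ and two vectors $\breve x_1,\breve x_2\in\mathbb{R}^n$ such that (IR.1) $\breve Z:=A_0+\breve\mu_1A_1+\breve\mu_2A_2+\breve\mu_3I_n\succeq0$ and the null space of $\breve Z$ equals the linear span of $\breve x_1,\breve x_2$; (IR.2) $\breve x_1^TA_1\breve x_1=\breve x_2^TA_1\breve x_2=0$ and $\breve x_1^TA_1\breve x_2\neq0$; (IR.3) $\breve x_1^TA_2\breve x_1<0<\breve x_2^TA_2\breve x_2$. *)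

theory Defs
  imports "HOL-Analysis.Analysis"
begin

definition symmetric_matrix :: "real^'n^'n \<Rightarrow> bool" where
  "symmetric_matrix A \<longleftrightarrow> transpose A = A"

definition pos_semidef :: "real^'n^'n \<Rightarrow> bool" where
  "pos_semidef A \<longleftrightarrow> symmetric_matrix A \<and> (\<forall>x. 0 \<le> x \<bullet> (A *v x))"

text \<open>The bilinear expression \<open>x\<^sup>T A y\<close> is written \<open>x \<bullet> (A *v y)\<close>. Linear
  independence of \<open>x1\<close> and \<open>x2\<close> is not required explicitly; it follows from the strict
  sign conditions on \<open>A2\<close>.\<close>

definition Property_IR :: "real^'n^'n \<Rightarrow> real^'n^'n \<Rightarrow> real^'n^'n \<Rightarrow> bool" where
  "Property_IR A0 A1 A2 \<longleftrightarrow>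
     (\<exists>(\<mu>1::real) (\<mu>2::real) (\<mu>3::real) (x1::real^'n) (x2::real^'n).
        0 < \<mu>1 \<and> 0 < \<mu>2 \<and> 0 < \<mu>3 \<and>
        (let Z = A0 + \<mu>1 *\<^sub>R A1 + \<mu>2 *\<^sub>R A2 + \<mu>3 *\<^sub>R mat 1
         in pos_semidef Z \<and> {x. Z *v x = 0} = span {x1, x2}) \<and>
        x1 \<bullet> (A1 *v x1) = 0 \<and> x2 \<bullet> (A1 *v x2) = 0 \<and> x1 \<bullet> (A1 *v x2) \<noteq> 0 \<and>
        x1 \<bullet> (A2 *v x1) < 0 \<and> 0 < x2 \<bullet> (A2 *v x2))"

end

(* Minimise the trace of A0 X over positive semidefinite X of trace one with tr (A1 X) \<le> 0 and
   tr (A2 X) \<le> 0. By separation the value v has a dual certificate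
   Z = A0 + \<mu>1 A1 + \<mu>2 A2 - v I \<succeq> 0; the Slater point makes the multiplier of A0 nonzero. If v \<ge> 0,
   the multipliers \<mu>1, \<mu>2 give (ii). If v < 0, the optimal X lives on the kernel N of Z, and A0 is
   negative wherever \<mu>1 A1 + \<mu>2 A2 is nonnegative on N. Splitting X into rank-one pieces then
   contradicts the insolvability of the system unless \<mu>1, \<mu>2 > 0, and in that case it yields x1, x2 in
   N isotropic for A1 with opposite signs for A2. As A1 and A2 have no common isotropic vector in N,
   a continuity argument gives N = span {x1, x2}, which is Property IR with \<mu>3 = - v. *)

theory Submission
  imports Defs
begin

section \<open>Quadratic forms and the kernel of a positive semidefinite matrix\<close>

abbreviation quad_form :: "real^'n^'n \<Rightarrow> real^'n \<Rightarrow> real" where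
  "quad_form A x \<equiv> x \<bullet> (A *v x)"

lemma symmetric_matrix_swap:
  assumes "symmetric_matrix A"
  shows "x \<bullet> (A *v y) = y \<bullet> (A *v x)"
proof -
  have "x \<bullet> (A *v y) = (x v* A) \<bullet> y"
    by (simp add: dot_lmul_matrix)
  also have "x v* A = A *v x"
    using assms by (metis symmetric_matrix_def transpose_matrix_vector)
  finally show ?thesis
    by (simp add: inner_commute)
qed

lemma quad_form_scaleR: "quad_form A (c *\<^sub>R x) = c\<^sup>2 * quad_form A x"
  by (simp add: matrix_vector_mult_scaleR power2_eq_square)

lemma quad_form_combination:
  "quad_form A (a *\<^sub>R x + b *\<^sub>R y) =
     a\<^sup>2 * quad_form A x + a * b * (x \<bullet> (A *v y) + y \<bullet> (A *v x)) + b\<^sup>2 * quad_form A y"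
  by (simp add: matrix_vector_mult_scaleR matrix_vector_right_distrib inner_add_left
      inner_add_right power2_eq_square algebra_simps)

lemma quad_form_mat_1: "quad_form (mat 1) x = (norm x)\<^sup>2"
  by (simp add: power2_norm_eq_inner)

lemma quad_form_matrix_add: "quad_form (A + B) x = quad_form A x + quad_form B x"
  by (simp add: matrix_vector_mult_add_rdistrib inner_add_right)

lemma quad_form_matrix_scaleR: "quad_form (c *\<^sub>R A) x = c * quad_form A x"
  by (simp add: scaleR_matrix_vector_assoc[symmetric])

lemma continuous_on_quad_form [continuous_intros]:
  "continuous_on S f \<Longrightarrow> continuous_on S (\<lambda>t. quad_form A (f t))"
  by (intro continuous_on_inner matrix_vector_mult_linear_continuous_on[THEN continuous_on_compose2])
    auto

lemma sum_list_quad_form_matrix_add: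
  "(\<Sum>x\<leftarrow>xs. quad_form (A + B) x) = (\<Sum>x\<leftarrow>xs. quad_form A x) + (\<Sum>x\<leftarrow>xs. quad_form B x)"
  by (simp add: quad_form_matrix_add sum_list_addf)

lemma sum_list_quad_form_matrix_scaleR:
  "(\<Sum>x\<leftarrow>xs. quad_form (c *\<^sub>R A) x) = c * (\<Sum>x\<leftarrow>xs. quad_form A x)"
  by (simp add: quad_form_matrix_scaleR sum_list_const_mult)

lemma symmetric_matrix_add:
  "symmetric_matrix A \<Longrightarrow> symmetric_matrix B \<Longrightarrow> symmetric_matrix (A + B)"
  by (simp add: symmetric_matrix_def transpose_def vec_eq_iff)

lemma symmetric_matrix_scaleR: "symmetric_matrix A \<Longrightarrow> symmetric_matrix (c *\<^sub>R A)"
  by (simp add: symmetric_matrix_def transpose_def vec_eq_iff)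

lemma symmetric_matrix_mat: "symmetric_matrix (mat c)"
  by (simp add: symmetric_matrix_def)

text \<open>For \<open>y = Z *v x\<close>, \<open>a = y \<bullet> y\<close> and
  \<open>c = quad_form Z y\<close>, the form at \<open>(c + 1) *\<^sub>R x - a *\<^sub>R y\<close>
  equals \<open>- (a\<^sup>2 * (c + 2))\<close> when it vanishes at \<open>x\<close>. It must be
  nonnegative and \<open>c \<ge> 0\<close>, which forces \<open>a = 0\<close>.\<close>

lemma pos_semidef_kernel:
  assumes "pos_semidef Z"
  shows "Z *v x = 0 \<longleftrightarrow> quad_form Z x = 0"
proof
  assume x: "quad_form Z x = 0"
  define y where "y = Z *v x"
  define a where "a = y \<bullet> y"
  define c where "c = quad_form Z y"
  have sym: "symmetric_matrix Z" and pos: "\<And>z. 0 \<le> quad_form Z z"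
    using assms by (auto simp: pos_semidef_def)
  have "c \<ge> 0" using pos c_def by simp
  have "x \<bullet> (Z *v y) = a" "y \<bullet> (Z *v x) = a"
    using symmetric_matrix_swap[OF sym, of x y] by (simp_all add: a_def y_def)
  then have "quad_form Z ((c + 1) *\<^sub>R x + (- a) *\<^sub>R y) = (c + 1) * (- a) * (a + a) + a\<^sup>2 * c"
    unfolding quad_form_combination x by (simp add: c_def)
  also have "\<dots> = - (a\<^sup>2 * (c + 2))"
    by (simp add: algebra_simps power2_eq_square)
  finally have "a\<^sup>2 * (c + 2) \<le> 0"
    using pos[of "(c + 1) *\<^sub>R x + (- a) *\<^sub>R y"] by linarith
  then have "a = 0"
    using \<open>c \<ge> 0\<close> by (simp add: mult_le_0_iff)
  then show "Z *v x = 0" by (simp add: a_def y_def)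
qed simp

section \<open>Rank-one decompositions\<close>

text \<open>Rotating a pair of vectors in its plane preserves the sum of their rank-one matrices, hence
  the sum of the values of every quadratic form; by the intermediate value theorem some rotation
  annihilates \<open>B\<close> on one of them.\<close>

lemma rotate_to_isotropic:
  assumes "quad_form B x < 0" "0 < quad_form B y"
  obtains u v where "u \<in> span {x, y}" "v \<in> span {x, y}" "quad_form B u = 0"
    "\<And>A. quad_form A u + quad_form A v = quad_form A x + quad_form A y"
proof -
  define u where "u t = cos t *\<^sub>R x + sin t *\<^sub>R y" for t :: real
  define v where "v t = (- sin t) *\<^sub>R x + cos t *\<^sub>R y" for t :: real
  have "continuous_on {0..pi/2} (\<lambda>t. quad_form B (u t))"
    unfolding u_def by (intro continuous_intros)
  moreover have "quad_form B (u 0) \<le> 0" "0 \<le> quad_form B (u (pi/2))"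
    using assms by (auto simp: u_def)
  ultimately obtain t where t: "quad_form B (u t) = 0"
    using IVT'[of "\<lambda>t. quad_form B (u t)" 0 0 "pi/2"] by auto
  have "quad_form A (u t) + quad_form A (v t) = quad_form A x + quad_form A y" for A
  proof -
    have "quad_form A (u t) + quad_form A (v t) =
      ((cos t)\<^sup>2 + (sin t)\<^sup>2) * quad_form A x + ((cos t)\<^sup>2 + (sin t)\<^sup>2) * quad_form A y"
      unfolding u_def v_def quad_form_combination
      by (simp add: algebra_simps del: sin_cos_squared_add sin_cos_squared_add2)
    then show ?thesis by simp
  qed
  moreover have "u t \<in> span {x, y}" "v t \<in> span {x, y}"
    unfolding u_def v_def by (intro span_add span_scale span_base; simp)+
  ultimately show thesis using that t by blast
qed

text \<open>A zero sum with a nonzero term has terms of both signs. Rotating two such vectors gives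
  one isotropic vector, which is kept, and one that replaces both, so the list gets shorter while
  every quadratic form keeps its sum.\<close>

lemma rank_one_decomposition:
  assumes "(\<Sum>x\<leftarrow>xs. quad_form B x) = 0" "subspace N" "set xs \<subseteq> N"
  shows "\<exists>ys. set ys \<subseteq> N \<and> (\<forall>y\<in>set ys. quad_form B y = 0) \<and>
    (\<forall>A. (\<Sum>y\<leftarrow>ys. quad_form A y) = (\<Sum>x\<leftarrow>xs. quad_form A x))"
  using assms
proof (induction "length xs" arbitrary: xs rule: less_induct)
  case less
  show ?case
  proof (cases "\<forall>x\<in>set xs. quad_form B x = 0")
    case True
    then show ?thesis using less.prems by blast
  next
    case False
    \<comment> \<open>Stated for an arbitrary matrix: applied to \<open>B\<close> it yields a
      negative value, applied to the negative of \<open>B\<close> a positive one.\<close>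
    have neg: "\<exists>x\<in>set xs. quad_form C x < 0"
      if z: "(\<Sum>x\<leftarrow>xs. quad_form C x) = 0" "\<exists>x\<in>set xs. quad_form C x \<noteq> 0" for C
    proof (rule ccontr)
      assume "\<not> ?thesis"
      then have "\<And>a. a \<in> set (map (quad_form C) xs) \<Longrightarrow> 0 \<le> a" by (auto simp: not_less)
      then show False using sum_list_nonneg_eq_0_iff[of "map (quad_form C) xs"] z by auto
    qed
    obtain x where x: "x \<in> set xs" "quad_form B x < 0"
      using neg[of B] False less.prems(1) by blast
    obtain y where y: "y \<in> set xs" "0 < quad_form B y"
      using neg[of "(-1) *\<^sub>R B"] False less.prems(1)
      unfolding sum_list_quad_form_matrix_scaleR unfolding quad_form_matrix_scaleR by auto
    define zs where "zs = remove1 y (remove1 x xs)"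
    have "x \<noteq> y" using x y by auto
    then have y': "y \<in> set (remove1 x xs)" using y by (simp add: in_set_remove1)
    have sum: "(\<Sum>x\<leftarrow>xs. quad_form A x) = quad_form A x + quad_form A y + (\<Sum>x\<leftarrow>zs. quad_form A x)" for A
      unfolding zs_def using sum_list_map_remove1[OF x(1), of "quad_form A"]
        sum_list_map_remove1[OF y', of "quad_form A"] by simp
    have "length zs + 2 = length xs"
      using x(1) y' length_pos_if_in_set[OF y'] length_pos_if_in_set[OF x(1)]
      unfolding zs_def by (simp add: length_remove1)
    have "set zs \<subseteq> N"
      using less.prems(3) unfolding zs_def by (meson notin_set_remove1 subset_iff)
    obtain u v where u: "u \<in> span {x, y}" and v: "v \<in> span {x, y}" and "quad_form B u = 0"
      and uv: "\<And>A. quad_form A u + quad_form A v = quad_form A x + quad_form A y"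
      using rotate_to_isotropic[OF x(2) y(2)] by blast
    have "span {x, y} \<subseteq> N"
      using x y less.prems by (intro span_minimal) auto
    then have "u \<in> N" "v \<in> N" using u v by auto
    have "(\<Sum>x\<leftarrow>v # zs. quad_form B x) = 0"
      using sum[of B] uv[of B] less.prems(1) \<open>quad_form B u = 0\<close> by simp
    moreover have "length (v # zs) < length xs" using \<open>length zs + 2 = length xs\<close> by simp
    moreover have "set (v # zs) \<subseteq> N" using \<open>v \<in> N\<close> \<open>set zs \<subseteq> N\<close> by simp
    ultimately obtain ys where ys: "set ys \<subseteq> N" "\<forall>y\<in>set ys. quad_form B y = 0"
      "\<And>A. (\<Sum>y\<leftarrow>ys. quad_form A y) = (\<Sum>x\<leftarrow>v # zs. quad_form A x)"
      using less.hyps[of "v # zs"] less.prems(2) by blast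
    show ?thesis
    proof (intro exI[of _ "u # ys"] conjI allI)
      show "(\<Sum>y\<leftarrow>u # ys. quad_form A y) = (\<Sum>x\<leftarrow>xs. quad_form A x)" for A
        using ys(3)[of A] sum[of A] uv[of A] by simp
    qed (use ys \<open>u \<in> N\<close> \<open>quad_form B u = 0\<close> in auto)
  qed
qed

section \<open>Isotropic vectors and paths in the isotropic cone\<close>

lemma common_isotropic_on_path:
  assumes cont: "continuous_on {0..1::real} g"
    and "quad_form B (g 0) < 0" "0 < quad_form B (g 1)"
    and "\<And>t. t \<in> {0..1} \<Longrightarrow> g t \<in> N" "\<And>t. t \<in> {0..1} \<Longrightarrow> g t \<noteq> 0"
    and "\<And>t. t \<in> {0..1} \<Longrightarrow> quad_form A (g t) = 0"
  shows "\<exists>z\<in>N. z \<noteq> 0 \<and> quad_form A z = 0 \<and> quad_form B z = 0"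
proof -
  have "continuous_on {0..1} (\<lambda>t. quad_form B (g t))"
    using cont by (rule continuous_on_quad_form)
  then obtain t where "0 \<le> t" "t \<le> 1" "quad_form B (g t) = 0"
    using IVT'[of "\<lambda>t. quad_form B (g t)" 0 0 1] assms(2,3) by auto
  then show ?thesis using assms(4-6)[of t] by auto
qed

text \<open>If \<open>N\<close> had a third dimension, the points \<open>x1\<close> and \<open>\<plusminus>x2\<close> could be joined by a path inside the
  cone of nonzero isotropic vectors of \<open>A\<close> in \<open>N\<close>, and \<open>B\<close> changes sign along that path.\<close>

lemma no_common_isotropic_imp_span:
  assumes A: "symmetric_matrix A" and N: "subspace N" "x1 \<in> N" "x2 \<in> N"
    and iso: "quad_form A x1 = 0" "quad_form A x2 = 0" "x1 \<bullet> (A *v x2) \<noteq> 0"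
    and B: "quad_form B x1 < 0" "0 < quad_form B x2"
    and no_common: "\<And>z. z \<in> N \<Longrightarrow> z \<noteq> 0 \<Longrightarrow> quad_form A z = 0 \<Longrightarrow> quad_form B z \<noteq> 0"
  shows "N = span {x1, x2}"
proof
  show "span {x1, x2} \<subseteq> N" using N by (intro span_minimal) auto
  have False if y: "y \<in> N" "y \<notin> span {x1, x2}" for y
  proof -
    define b where "b = x1 \<bullet> (A *v x2)"
    \<comment> \<open>As \<open>b \<noteq> 0\<close>, the plane of \<open>x1\<close> and
      \<open>x2\<close> is hyperbolic for \<open>A\<close>, so subtracting multiples of
      \<open>x1\<close> and \<open>x2\<close> makes \<open>y\<close> orthogonal to both with respect
      to \<open>A\<close>.\<close>
    define w where "w = y - ((x2 \<bullet> (A *v y)) / b) *\<^sub>R x1 - ((x1 \<bullet> (A *v y)) / b) *\<^sub>R x2"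
    define c where "c = quad_form A w"
    have b: "b \<noteq> 0" "x2 \<bullet> (A *v x1) = b"
      using iso symmetric_matrix_swap[OF A, of x1 x2] by (auto simp: b_def)
    have "w \<in> N" unfolding w_def using N y by (intro subspace_diff subspace_scale)
    have w1: "x1 \<bullet> (A *v w) = 0" and w2: "x2 \<bullet> (A *v w) = 0"
      using b iso by (simp_all add: w_def matrix_vector_mult_diff_distrib matrix_vector_mult_scaleR
          inner_diff_right flip: b_def)
    have w1': "w \<bullet> (A *v x1) = 0" and w2': "w \<bullet> (A *v x2) = 0"
      using w1 w2 symmetric_matrix_swap[OF A] by metis+
    have w_span: "w \<notin> span {x1, x2}"
    proof
      assume "w \<in> span {x1, x2}"
      then have "w + ((x2 \<bullet> (A *v y)) / b) *\<^sub>R x1 + ((x1 \<bullet> (A *v y)) / b) *\<^sub>R x2 \<in> span {x1, x2}"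
        by (intro span_add span_scale) (auto intro: span_base)
      then show False using y by (simp add: w_def)
    qed
    \<comment> \<open>Only the coefficient of \<open>w\<close> is claimed to vanish; where it does,
      each path below is at a nonzero multiple of \<open>x1\<close> or \<open>x2\<close>.\<close>
    have indep: "r = 0" if "s *\<^sub>R x1 + t *\<^sub>R x2 + r *\<^sub>R w = 0" for r s t
    proof (rule ccontr)
      assume "r \<noteq> 0"
      have "r *\<^sub>R w = - (s *\<^sub>R x1 + t *\<^sub>R x2)" using that by (metis eq_neg_iff_add_eq_0 add.commute)
      moreover have "- (s *\<^sub>R x1 + t *\<^sub>R x2) \<in> span {x1, x2}"
        by (intro span_neg span_add span_scale) (auto intro: span_base)
      ultimately show False using w_span \<open>r \<noteq> 0\<close> span_scale
        by (metis scaleR_scaleR left_inverse scaleR_one)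
    qed
    have Ag: "quad_form A (s *\<^sub>R x1 + t *\<^sub>R x2 + r *\<^sub>R w) = 2 * b * s * t + c * r\<^sup>2" for s t r
      using b iso w1 w2 w1' w2'
      by (simp add: matrix_vector_mult_scaleR matrix_vector_right_distrib inner_add_left
          inner_add_right power2_eq_square c_def flip: b_def)
    have gN: "s *\<^sub>R x1 + t *\<^sub>R x2 + r *\<^sub>R w \<in> N" for s t r
      using N \<open>w \<in> N\<close> by (intro subspace_add subspace_scale)
    have "x1 \<noteq> 0" "x2 \<noteq> 0" "w \<noteq> 0" using B w_span by (auto simp: span_0)
    have "\<exists>z\<in>N. z \<noteq> 0 \<and> quad_form A z = 0 \<and> quad_form B z = 0"
    proof (cases "c = 0")
      case False
      \<comment> \<open>Along \<open>g\<close> the \<open>A\<close>-value is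
        \<open>(u * (1 - u))\<^sup>2\<close> times \<open>2 * b * e + c * k\<^sup>2\<close>. The
        sign \<open>e\<close> makes \<open>b * e\<close> opposite to \<open>c\<close>, so that a
        real \<open>k\<close> cancels the factor; ending at \<open>- x2\<close> instead of
        \<open>x2\<close> is harmless because quadratic forms are even.\<close>
      define e where "e = - sgn (b * c)"
      define k where "k = sqrt (2 * \<bar>b\<bar> / \<bar>c\<bar>)"
      define g where "g u = (1 - u)\<^sup>2 *\<^sub>R x1 + (e * u\<^sup>2) *\<^sub>R x2 + (k * u * (1 - u)) *\<^sub>R w" for u :: real
      have e2: "e = 1 \<or> e = -1" using b False by (auto simp: e_def sgn_if)
      have "k \<noteq> 0" using b False by (simp add: k_def)
      have "k\<^sup>2 = 2 * \<bar>b\<bar> / \<bar>c\<bar>" by (simp add: k_def)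
      then have k2: "c * k\<^sup>2 = - 2 * b * e"
        using b False by (auto simp: e_def sgn_if abs_if zero_less_mult_iff field_simps split: if_splits)
      show ?thesis
      proof (rule common_isotropic_on_path[of g])
        show "continuous_on {0..1} g" unfolding g_def by (intro continuous_intros)
        show "quad_form B (g 0) < 0" using B by (simp add: g_def)
        have "g 1 = e *\<^sub>R x2" by (simp add: g_def)
        then have "quad_form B (g 1) = e\<^sup>2 * quad_form B x2" by (simp only: quad_form_scaleR)
        then show "0 < quad_form B (g 1)" using B e2 by auto
        show "g t \<in> N" for t unfolding g_def by (rule gN)
        show "quad_form A (g t) = 0" for t
        proof -
          have "quad_form A (g t) = (t * (1 - t))\<^sup>2 * (2 * b * e + c * k\<^sup>2)"
            unfolding g_def Ag by (simp add: power2_eq_square algebra_simps)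
          then show ?thesis using k2 by simp
        qed
        show "g t \<noteq> 0" for t
        proof
          assume "g t = 0"
          then have "k * t * (1 - t) = 0" unfolding g_def by (rule indep)
          then have "t = 0 \<or> t = 1" using \<open>k \<noteq> 0\<close> by auto
          then show False using \<open>g t = 0\<close> \<open>x1 \<noteq> 0\<close> \<open>x2 \<noteq> 0\<close> e2 by (auto simp: g_def)
        qed
      qed
    next
      \<comment> \<open>Now \<open>w\<close> is itself isotropic and \<open>A\<close>-orthogonal to
        \<open>x1\<close> and \<open>x2\<close>, so the segments from \<open>w\<close> to either of
        them are isotropic. It is joined to the one with the opposite \<open>B\<close>-sign.\<close>
      case c: True
      show ?thesis
      proof (cases "quad_form B w" "0::real" rule: linorder_cases)
        case less
        define g where "g u = 0 *\<^sub>R x1 + u *\<^sub>R x2 + (1 - u) *\<^sub>R w" for u :: real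
        show ?thesis
        proof (rule common_isotropic_on_path[of g])
          show "continuous_on {0..1} g" unfolding g_def by (intro continuous_intros)
          show "quad_form B (g 0) < 0" "0 < quad_form B (g 1)" using B less by (simp_all add: g_def)
          show "g t \<in> N" for t unfolding g_def by (rule gN)
          show "quad_form A (g t) = 0" for t unfolding g_def Ag by (simp add: c)
          show "g t \<noteq> 0" for t
          proof
            assume "g t = 0"
            then have "1 - t = 0" unfolding g_def by (rule indep)
            then show False using \<open>g t = 0\<close> \<open>x2 \<noteq> 0\<close> by (simp add: g_def)
          qed
        qed
      next
        case equal
        then show ?thesis using c \<open>w \<in> N\<close> \<open>w \<noteq> 0\<close> c_def by auto
      next
        case greater
        define g where "g u = (1 - u) *\<^sub>R x1 + 0 *\<^sub>R x2 + u *\<^sub>R w" for u :: real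
        show ?thesis
        proof (rule common_isotropic_on_path[of g])
          show "continuous_on {0..1} g" unfolding g_def by (intro continuous_intros)
          show "quad_form B (g 0) < 0" "0 < quad_form B (g 1)" using B greater by (simp_all add: g_def)
          show "g t \<in> N" for t unfolding g_def by (rule gN)
          show "quad_form A (g t) = 0" for t unfolding g_def Ag by (simp add: c)
          show "g t \<noteq> 0" for t
          proof
            assume "g t = 0"
            then have "t = 0" unfolding g_def by (rule indep)
            then show False using \<open>g t = 0\<close> \<open>x1 \<noteq> 0\<close> by (simp add: g_def)
          qed
        qed
      qed
    qed
    then show False using no_common by blast
  qed
  then show "N \<subseteq> span {x1, x2}" by blast
qed

section \<open>Strong duality for the trace-one relaxation\<close>

definition joint_form :: "real^'n^'n \<Rightarrow> real^'n^'n \<Rightarrow> real^'n^'n \<Rightarrow> real^'n \<Rightarrow> real \<times> real \<times> real" where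
  "joint_form A0 A1 A2 x = (quad_form A0 x, quad_form A1 x, quad_form A2 x)"

text \<open>A list \<open>xs\<close> stands for the positive semidefinite matrix \<open>X = (\<Sum>x\<leftarrow>xs. x x\<^sup>T)\<close>: the trace of
  \<open>A X\<close> is \<open>\<Sum>x\<leftarrow>xs. quad_form A x\<close>, and \<open>A = mat 1\<close> gives the trace of \<open>X\<close>.\<close>

lemma convex_hull_joint_form:
  fixes A0 A1 A2 :: "real^'n^'n"
  assumes "p \<in> convex hull (joint_form A0 A1 A2 ` sphere 0 1)"
  shows "\<exists>xs. p = (\<Sum>x\<leftarrow>xs. joint_form A0 A1 A2 x) \<and> (\<Sum>x\<leftarrow>xs. quad_form (mat 1) x) = 1"
proof -
  let ?J = "joint_form A0 A1 A2"
  let ?S = "{p. \<exists>xs. p = (\<Sum>x\<leftarrow>xs. ?J x) \<and> (\<Sum>x\<leftarrow>xs. quad_form (mat 1) x) = 1}"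
  have scale: "?J (c *\<^sub>R x) = c\<^sup>2 *\<^sub>R ?J x" for c x
    unfolding joint_form_def quad_form_scaleR by simp
  have "convex ?S"
  proof (rule convexI)
    fix p q and s t :: real
    assume "p \<in> ?S" "q \<in> ?S" and st: "0 \<le> s" "0 \<le> t" "s + t = 1"
    then obtain xs ys where xs: "p = (\<Sum>x\<leftarrow>xs. ?J x)" "(\<Sum>x\<leftarrow>xs. quad_form (mat 1) x) = 1"
      and ys: "q = (\<Sum>x\<leftarrow>ys. ?J x)" "(\<Sum>x\<leftarrow>ys. quad_form (mat 1) x) = 1"
      by blast
    have J: "(\<Sum>x\<leftarrow>map (\<lambda>x. sqrt c *\<^sub>R x) zs. ?J x) = c *\<^sub>R (\<Sum>x\<leftarrow>zs. ?J x)"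
      if "0 \<le> c" for c zs
      using that by (induction zs) (simp_all add: scale scaleR_add_right)
    have I: "(\<Sum>x\<leftarrow>map (\<lambda>x. sqrt c *\<^sub>R x) zs. quad_form (mat 1) x) = c * (\<Sum>x\<leftarrow>zs. quad_form (mat 1) x)"
      if "0 \<le> c" for c and zs :: "(real^'n) list"
      using that by (induction zs) (simp_all add: distrib_left)
    \<comment> \<open>Scaling the vectors by square roots of the weights and concatenating the lists
      realises the convex combination of the two matrices.\<close>
    let ?zs = "map (\<lambda>x. sqrt s *\<^sub>R x) xs @ map (\<lambda>x. sqrt t *\<^sub>R x) ys"
    have "s *\<^sub>R p + t *\<^sub>R q = (\<Sum>x\<leftarrow>?zs. ?J x)"
      using J[of s xs] J[of t ys] st xs ys by (simp del: map_map)
    moreover have "(\<Sum>x\<leftarrow>?zs. quad_form (mat 1) x) = 1"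
      using I[of s xs] I[of t ys] st xs ys by (simp del: map_map)
    ultimately show "s *\<^sub>R p + t *\<^sub>R q \<in> ?S" by blast
  qed
  moreover have "?J ` sphere 0 1 \<subseteq> ?S"
  proof
    fix p assume "p \<in> ?J ` sphere 0 1"
    then obtain x where "p = ?J x" "norm x = 1" by auto
    then show "p \<in> ?S"
      by (intro CollectI exI[of _ "[x]"]) (simp add: quad_form_mat_1 del: matrix_vector_mul_lid)
  qed
  ultimately show ?thesis using hull_minimal[of _ ?S convex] assms by blast
qed

lemma sum_list_joint_form:
  "(\<Sum>x\<leftarrow>xs. joint_form A0 A1 A2 x) =
     ((\<Sum>x\<leftarrow>xs. quad_form A0 x), (\<Sum>x\<leftarrow>xs. quad_form A1 x), (\<Sum>x\<leftarrow>xs. quad_form A2 x))"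
  by (induction xs) (simp_all add: joint_form_def zero_prod_def)

text \<open>The bound extends from the open orthant with corner \<open>(v, 0, 0)\<close> to the
  closed one, and a negative coefficient would make the left side unbounded along its coordinate
  ray.\<close>

lemma nonneg_multipliers_of_upper_bound:
  fixes l0 l1 l2 v \<beta> :: real
  assumes "\<And>a b c. a < v \<Longrightarrow> b < 0 \<Longrightarrow> c < 0 \<Longrightarrow> l0 * a + l1 * b + l2 * c \<le> \<beta>"
  shows "0 \<le> l0" "0 \<le> l1" "0 \<le> l2" "l0 * v \<le> \<beta>"
proof -
  have lim: "l0 * a + l1 * b + l2 * c \<le> \<beta>" if "a \<le> v" "b \<le> 0" "c \<le> 0" for a b c
  proof (rule field_le_epsilon)
    fix e :: real assume "0 < e"
    \<comment> \<open>Shifting each coordinate down by \<open>d\<close> lowers the left side by at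
      most \<open>e\<close>; the added 1 keeps the denominator positive.\<close>
    define d where "d = e / (\<bar>l0\<bar> + \<bar>l1\<bar> + \<bar>l2\<bar> + 1)"
    have "d > 0" using \<open>0 < e\<close> by (simp add: d_def)
    have "l0 * (a - d) + l1 * (b - d) + l2 * (c - d) \<le> \<beta>"
      using that \<open>d > 0\<close> by (intro assms) auto
    moreover have "d * (l0 + l1 + l2) \<le> d * (\<bar>l0\<bar> + \<bar>l1\<bar> + \<bar>l2\<bar> + 1)"
      using \<open>d > 0\<close> by (intro mult_left_mono) auto
    moreover have "d * (\<bar>l0\<bar> + \<bar>l1\<bar> + \<bar>l2\<bar> + 1) = e" by (simp add: d_def)
    ultimately show "l0 * a + l1 * b + l2 * c \<le> \<beta> + e" by (simp add: algebra_simps)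
  qed
  show v: "l0 * v \<le> \<beta>" using lim[of v 0 0] by simp
  have "0 \<le> l" if "\<And>s. 0 \<le> s \<Longrightarrow> l0 * v - s * l \<le> \<beta>" for l
  proof (rule ccontr)
    assume "\<not> 0 \<le> l"
    \<comment> \<open>This step length along the ray gives the value
      \<open>\<beta> + 1\<close>.\<close>
    then show False using that[of "(\<beta> - l0 * v + 1) / (- l)"] v by (simp add: field_simps)
  qed
  from this[of l0] this[of l1] this[of l2] show "0 \<le> l0" "0 \<le> l1" "0 \<le> l2"
    using lim[of "v - _" 0 0] lim[of v "- _" 0] lim[of v 0 "- _"] by (simp_all add: algebra_simps)
qed

text \<open>The list \<open>xs\<close> is a primal minimiser, and \<open>\<mu>1\<close>,
  \<open>\<mu>2\<close>, \<open>v\<close> form a dual solution of the same value. Compactness of the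
  convex hull \<open>K\<close> gives the minimiser; separating \<open>K\<close> from the open
  orthant of strictly better triples gives the multipliers.\<close>

lemma trace_one_strong_duality:
  fixes A0 A1 A2 :: "real^'n^'n"
  assumes x0: "quad_form A1 x0 < 0" "quad_form A2 x0 < 0"
  obtains \<mu>1 \<mu>2 v xs where "0 \<le> \<mu>1" "0 \<le> \<mu>2"
    "\<And>x. v * (norm x)\<^sup>2 \<le> quad_form A0 x + \<mu>1 * quad_form A1 x + \<mu>2 * quad_form A2 x"
    "(\<Sum>x\<leftarrow>xs. quad_form A0 x) = v" "(\<Sum>x\<leftarrow>xs. quad_form A1 x) \<le> 0"
    "(\<Sum>x\<leftarrow>xs. quad_form A2 x) \<le> 0" "(\<Sum>x\<leftarrow>xs. quad_form (mat 1) x) = 1"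
proof -
  let ?J = "joint_form A0 A1 A2"
  define K where "K = convex hull (?J ` sphere 0 1)"
  have "continuous_on (sphere 0 1) ?J"
    unfolding joint_form_def by (intro continuous_intros)
  then have "compact K"
    unfolding K_def by (intro compact_convex_hull compact_continuous_image compact_sphere)
  define F where "F = K \<inter> (UNIV \<times> {..0} \<times> {..0})"
  have "compact F"
    unfolding F_def using \<open>compact K\<close> by (intro compact_Int_closed closed_Times) auto
  define e where "e = (1 / norm x0) *\<^sub>R x0"
  have "x0 \<noteq> 0" using x0 by auto
  then have "norm e = 1" by (simp add: e_def)
  have e: "quad_form A1 e < 0" "quad_form A2 e < 0"
    using x0 \<open>x0 \<noteq> 0\<close> unfolding e_def quad_form_scaleR by (simp_all add: mult_pos_neg)
  have JK: "?J x \<in> K" if "norm x = 1" for x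
    unfolding K_def using that by (intro hull_inc imageI) simp
  have "?J e \<in> F" unfolding F_def using e JK[OF \<open>norm e = 1\<close>] by (auto simp: joint_form_def)
  then obtain p where p: "p \<in> F" "\<And>q. q \<in> F \<Longrightarrow> fst p \<le> fst q"
    using continuous_attains_inf[OF \<open>compact F\<close> _ continuous_on_fst[OF continuous_on_id]]
    by (metis empty_iff)
  define v where "v = fst p"
  obtain xs where xs: "p = (\<Sum>x\<leftarrow>xs. ?J x)" "(\<Sum>x\<leftarrow>xs. quad_form (mat 1) x) = 1"
    using convex_hull_joint_form[of p A0 A1 A2] p(1) unfolding F_def K_def by auto
  define U :: "(real \<times> real \<times> real) set" where "U = {..<v} \<times> {..<0} \<times> {..<0}"
  \<comment> \<open>A point of \<open>K\<close> in \<open>U\<close> would be feasible with first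
    coordinate below the minimum \<open>v\<close>.\<close>
  have "U \<inter> K = {}"
    using p(2) unfolding U_def F_def v_def by force
  moreover have "convex U" "convex K" unfolding U_def K_def by (auto intro!: convex_Times)
  moreover have "(v - 1, -1, -1) \<in> U" by (simp add: U_def)
  moreover have "K \<noteq> {}" using JK[OF \<open>norm e = 1\<close>] by auto
  ultimately obtain l \<beta> where l: "l \<noteq> 0" "\<And>q. q \<in> U \<Longrightarrow> l \<bullet> q \<le> \<beta>" "\<And>q. q \<in> K \<Longrightarrow> \<beta> \<le> l \<bullet> q"
    using separating_hyperplane_sets[of U K] by (metis empty_iff)
  obtain l0 l1 l2 where l_eq: "l = (l0, l1, l2)" by (cases l)
  have ub: "l0 * a + l1 * b + l2 * c \<le> \<beta>" if "a < v" "b < 0" "c < 0" for a b c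
    using l(2)[of "(a, b, c)"] that by (simp add: l_eq U_def)
  have nn: "0 \<le> l0" "0 \<le> l1" "0 \<le> l2" "l0 * v \<le> \<beta>"
    using nonneg_multipliers_of_upper_bound[of v l0 l1 l2 \<beta>] ub by blast+
  have lb: "l0 * v \<le> l0 * quad_form A0 x + l1 * quad_form A1 x + l2 * quad_form A2 x"
    if "norm x = 1" for x
    using l(3)[OF JK[OF that]] nn(4) by (simp add: l_eq joint_form_def)
  \<comment> \<open>If \<open>l0 = 0\<close>, the bound at the normalised Slater point
    \<open>e\<close>, where both constraint forms are negative, forces \<open>l1 = l2 = 0\<close>
    and hence \<open>l = 0\<close>.\<close>
  have "l0 > 0"
  proof (rule ccontr)
    assume "\<not> l0 > 0"
    then have "l0 = 0" using nn(1) by simp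
    then have "0 \<le> l1 * quad_form A1 e + l2 * quad_form A2 e" using lb[OF \<open>norm e = 1\<close>] by simp
    moreover have "l1 * quad_form A1 e \<le> 0" "l2 * quad_form A2 e \<le> 0"
      using nn e by (simp_all add: mult_nonneg_nonpos)
    ultimately have "l1 * quad_form A1 e = 0" "l2 * quad_form A2 e = 0" by linarith+
    then show False using e l(1) \<open>l0 = 0\<close> by (auto simp: l_eq zero_prod_def)
  qed
  show thesis
  proof (rule that[of "l1 / l0" "l2 / l0" v xs])
    show "v * (norm x)\<^sup>2 \<le> quad_form A0 x + l1 / l0 * quad_form A1 x + l2 / l0 * quad_form A2 x" for x
    proof (cases "x = 0")
      case False
      have "l0 * v \<le> (1 / norm x)\<^sup>2 * (l0 * quad_form A0 x + l1 * quad_form A1 x + l2 * quad_form A2 x)"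
        using lb[of "(1 / norm x) *\<^sub>R x"] False unfolding quad_form_scaleR by (simp add: algebra_simps)
      then have "l0 * v * (norm x)\<^sup>2 \<le> l0 * quad_form A0 x + l1 * quad_form A1 x + l2 * quad_form A2 x"
        using False by (simp add: power_divide pos_le_divide_eq)
      then show ?thesis using \<open>l0 > 0\<close> by (simp add: field_simps)
    qed simp
  qed (use nn \<open>l0 > 0\<close> xs p(1) in \<open>auto simp: F_def v_def sum_list_joint_form\<close>)
qed

section \<open>Property IR from a negative optimal value\<close>

lemma exists_nonpos_of_sum_list_nonpos:
  assumes "(\<Sum>y\<leftarrow>ys. quad_form A y) \<le> 0" "(\<Sum>y\<leftarrow>ys. quad_form (mat 1) y) = 1"
  shows "\<exists>y\<in>set ys. y \<noteq> 0 \<and> quad_form A y \<le> 0"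
proof (rule ccontr)
  assume neg: "\<not> ?thesis"
  \<comment> \<open>Every nonzero vector of the list has a positive value, so a nonpositive sum
    leaves only zero vectors, against trace one.\<close>
  then have "\<And>a. a \<in> set (map (quad_form A) ys) \<Longrightarrow> 0 \<le> a" by force
  with assms(1) have "\<forall>y\<in>set ys. quad_form A y = 0"
    using sum_list_nonneg_eq_0_iff[of "map (quad_form A) ys"] sum_list_nonneg[of "map (quad_form A) ys"]
    by auto
  then have "\<forall>y\<in>set ys. y = 0" using neg by force
  then have "(\<Sum>y\<leftarrow>ys. quad_form (mat 1) y) = (\<Sum>y\<leftarrow>ys. 0)"
    by (intro arg_cong[where f = sum_list] map_cong) auto
  then show False using assms(2) by simp
qed

text \<open>Decomposing along \<open>A - c *\<^sub>R mat 1\<close> distributes the trace inequality for \<open>A\<close> equally, so that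
  every summand satisfies it; one summand must then satisfy the inequality for \<open>B\<close> as well.\<close>

lemma feasible_rank_one:
  assumes N: "subspace N" "set xs \<subseteq> N"
    and A: "(\<Sum>x\<leftarrow>xs. quad_form A x) = c" and B: "(\<Sum>x\<leftarrow>xs. quad_form B x) \<le> 0"
    and one: "(\<Sum>x\<leftarrow>xs. quad_form (mat 1) x) = 1"
  shows "\<exists>x\<in>N. x \<noteq> 0 \<and> quad_form A x = c * (norm x)\<^sup>2 \<and> quad_form B x \<le> 0"
proof -
  have "(\<Sum>x\<leftarrow>xs. quad_form (A + (- c) *\<^sub>R mat 1) x) = 0"
    unfolding sum_list_quad_form_matrix_add sum_list_quad_form_matrix_scaleR A one by simp
  from rank_one_decomposition[OF this N] obtain ys where
    ys: "set ys \<subseteq> N" "\<forall>y\<in>set ys. quad_form (A + (- c) *\<^sub>R mat 1) y = 0"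
    "\<And>C. (\<Sum>y\<leftarrow>ys. quad_form C y) = (\<Sum>x\<leftarrow>xs. quad_form C x)"
    by blast
  obtain y where "y \<in> set ys" "y \<noteq> 0" "quad_form B y \<le> 0"
    using exists_nonpos_of_sum_list_nonpos[of B ys] ys(3) B one by metis
  moreover from this have "quad_form A y = c * (norm y)\<^sup>2"
    using ys(2) unfolding quad_form_matrix_add quad_form_matrix_scaleR quad_form_mat_1 by auto
  ultimately show ?thesis using ys(1) by blast
qed

lemma quad_form_pencil:
  "quad_form (A0 + \<mu>1 *\<^sub>R A1 + \<mu>2 *\<^sub>R A2) x =
     quad_form A0 x + \<mu>1 * quad_form A1 x + \<mu>2 * quad_form A2 x"
  by (simp add: quad_form_matrix_add quad_form_matrix_scaleR)

text \<open>Complementary slackness confines the optimal list to the kernel \<open>N\<close> of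
  \<open>Z\<close>, where \<open>A0\<close> is determined by the two constraint forms and the norm.
  The witnesses \<open>x1\<close> and \<open>x2\<close> come from decomposing the list along
  \<open>A1\<close> and reading off the signs of \<open>A2\<close>.\<close>

lemma Property_IR_of_negative_value:
  assumes sym: "symmetric_matrix A0" "symmetric_matrix A1" "symmetric_matrix A2"
    and \<mu>: "0 \<le> \<mu>1" "0 \<le> \<mu>2" and "v < 0"
    and lb: "\<And>x. v * (norm x)\<^sup>2 \<le> quad_form A0 x + \<mu>1 * quad_form A1 x + \<mu>2 * quad_form A2 x"
    and xs: "(\<Sum>x\<leftarrow>xs. quad_form A0 x) = v" "(\<Sum>x\<leftarrow>xs. quad_form A1 x) \<le> 0"
    "(\<Sum>x\<leftarrow>xs. quad_form A2 x) \<le> 0" "(\<Sum>x\<leftarrow>xs. quad_form (mat 1) x) = 1"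
    and infeasible: "\<And>x. quad_form A1 x \<le> 0 \<Longrightarrow> quad_form A2 x \<le> 0 \<Longrightarrow> 0 \<le> quad_form A0 x"
  shows "Property_IR A0 A1 A2"
proof -
  define Z where "Z = A0 + \<mu>1 *\<^sub>R A1 + \<mu>2 *\<^sub>R A2 + (- v) *\<^sub>R mat 1"
  have Z: "quad_form Z x =
      quad_form A0 x + \<mu>1 * quad_form A1 x + \<mu>2 * quad_form A2 x - v * (norm x)\<^sup>2" for x
    unfolding Z_def quad_form_matrix_add quad_form_matrix_scaleR quad_form_mat_1 by simp
  have psd: "pos_semidef Z"
    unfolding pos_semidef_def Z using lb sym unfolding Z_def
    by (simp add: symmetric_matrix_add symmetric_matrix_scaleR symmetric_matrix_mat
        del: scaleR_minus_left)
  define N where "N = {x. Z *v x = 0}"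
  have N: "subspace N"
    unfolding N_def by (auto simp: subspace_def matrix_vector_right_distrib matrix_vector_mult_scaleR)
  have on_N: "quad_form A0 x = v * (norm x)\<^sup>2 - \<mu>1 * quad_form A1 x - \<mu>2 * quad_form A2 x" if "x \<in> N" for x
    using that Z[of x] by (simp add: N_def)
  have neg: "v * (norm x)\<^sup>2 < 0" if "x \<noteq> 0" for x :: "real^'n"
    using that \<open>v < 0\<close> by (simp add: mult_neg_pos)

  \<comment> \<open>This sum is nonnegative because \<open>Z\<close> is positive semidefinite, and
    nonpositive because both products on the right are; so all three vanish.\<close>
  have sumZ: "(\<Sum>x\<leftarrow>xs. quad_form Z x) = \<mu>1 * (\<Sum>x\<leftarrow>xs. quad_form A1 x) + \<mu>2 * (\<Sum>x\<leftarrow>xs. quad_form A2 x)"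
    unfolding Z_def sum_list_quad_form_matrix_add sum_list_quad_form_matrix_scaleR xs by simp
  have nonneg: "\<And>a. a \<in> set (map (quad_form Z) xs) \<Longrightarrow> 0 \<le> a"
    using psd by (auto simp: pos_semidef_def)
  have "\<mu>1 * (\<Sum>x\<leftarrow>xs. quad_form A1 x) \<le> 0" "\<mu>2 * (\<Sum>x\<leftarrow>xs. quad_form A2 x) \<le> 0"
    using \<mu> xs by (simp_all add: mult_nonneg_nonpos)
  moreover have "0 \<le> (\<Sum>x\<leftarrow>xs. quad_form Z x)" using nonneg by (rule sum_list_nonneg)
  ultimately have slack: "\<mu>1 * (\<Sum>x\<leftarrow>xs. quad_form A1 x) = 0" "\<mu>2 * (\<Sum>x\<leftarrow>xs. quad_form A2 x) = 0"
    and "(\<Sum>x\<leftarrow>xs. quad_form Z x) = 0" using sumZ by linarith+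
  then have "set xs \<subseteq> N"
    using sum_list_nonneg_eq_0_iff[of "map (quad_form Z) xs"] nonneg
      pos_semidef_kernel[OF psd] by (auto simp: N_def)

  \<comment> \<open>With \<open>\<mu>1 = 0\<close>, the rank-one vector in \<open>N\<close> has
    \<open>\<mu>2 * quad_form A2 x = 0\<close>, so
    \<open>quad_form A0 x = v * (norm x)\<^sup>2 < 0\<close> and \<open>x\<close> solves the system.
    For \<open>\<mu>2\<close> the roles of \<open>A1\<close> and \<open>A2\<close> are
    exchanged.\<close>
  have "\<mu>1 \<noteq> 0"
  proof
    assume "\<mu>1 = 0"
    obtain x where x: "x \<in> N" "x \<noteq> 0" "quad_form A2 x = (\<Sum>x\<leftarrow>xs. quad_form A2 x) * (norm x)\<^sup>2"
      "quad_form A1 x \<le> 0"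
      using feasible_rank_one[OF N \<open>set xs \<subseteq> N\<close> refl xs(2,4)] by blast
    then have "\<mu>2 * quad_form A2 x = 0" using slack by simp
    then have "quad_form A0 x < 0" using on_N[OF x(1)] neg[OF x(2)] \<open>\<mu>1 = 0\<close> by auto
    moreover have "quad_form A2 x \<le> 0" using x(3) xs(3) by (simp add: mult_nonpos_nonneg)
    ultimately show False using infeasible[of x] x(4) by simp
  qed
  have "\<mu>2 \<noteq> 0"
  proof
    assume "\<mu>2 = 0"
    obtain x where x: "x \<in> N" "x \<noteq> 0" "quad_form A1 x = (\<Sum>x\<leftarrow>xs. quad_form A1 x) * (norm x)\<^sup>2"
      "quad_form A2 x \<le> 0"
      using feasible_rank_one[OF N \<open>set xs \<subseteq> N\<close> refl xs(3,4)] by blast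
    then have "\<mu>1 * quad_form A1 x = 0" using slack by simp
    then have "quad_form A0 x < 0" using on_N[OF x(1)] neg[OF x(2)] \<open>\<mu>2 = 0\<close> by auto
    moreover have "quad_form A1 x \<le> 0" using x(3) xs(2) by (simp add: mult_nonpos_nonneg)
    ultimately show False using infeasible[of x] x(4) by simp
  qed
  have sum0: "(\<Sum>x\<leftarrow>xs. quad_form A1 x) = 0" "(\<Sum>x\<leftarrow>xs. quad_form A2 x) = 0"
    using slack \<open>\<mu>1 \<noteq> 0\<close> \<open>\<mu>2 \<noteq> 0\<close> by auto
  \<comment> \<open>At a nonzero common isotropic vector in \<open>N\<close>,
    \<open>quad_form A0 z\<close> would be \<open>v * (norm z)\<^sup>2\<close>, a negative number,
    and \<open>z\<close> would solve the system.\<close>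
  have no_common: "quad_form A2 z \<noteq> 0" if "z \<in> N" "z \<noteq> 0" "quad_form A1 z = 0" for z
    using infeasible[of z] on_N[OF that(1)] neg[OF that(2)] that(3) by auto

  obtain ys where ys: "set ys \<subseteq> N" "\<forall>y\<in>set ys. quad_form A1 y = 0"
    "\<And>C. (\<Sum>y\<leftarrow>ys. quad_form C y) = (\<Sum>x\<leftarrow>xs. quad_form C x)"
    using rank_one_decomposition[OF sum0(1) N \<open>set xs \<subseteq> N\<close>] by blast
  \<comment> \<open>The choices \<open>s = 1\<close> and \<open>s = -1\<close> give vectors with
    nonpositive and nonnegative \<open>A2\<close>-value; \<open>no_common\<close> makes both signs
    strict.\<close>
  have ysB: "\<exists>y\<in>set ys. y \<noteq> 0 \<and> quad_form (s *\<^sub>R A2) y \<le> 0" for s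
    by (rule exists_nonpos_of_sum_list_nonpos)
      (simp_all only: ys(3) sum_list_quad_form_matrix_scaleR sum0 xs)
  obtain x1 where x1: "x1 \<in> set ys" "x1 \<noteq> 0" "quad_form A2 x1 \<le> 0"
    using ysB[of 1] unfolding quad_form_matrix_scaleR by auto
  obtain x2 where x2: "x2 \<in> set ys" "x2 \<noteq> 0" "0 \<le> quad_form A2 x2"
    using ysB[of "-1"] unfolding quad_form_matrix_scaleR by auto
  have xN: "x1 \<in> N" "x2 \<in> N" and A1: "quad_form A1 x1 = 0" "quad_form A1 x2 = 0"
    using x1 x2 ys by auto
  then have A2: "quad_form A2 x1 < 0" "0 < quad_form A2 x2"
    using x1 x2 no_common by (metis order_less_le)+
  \<comment> \<open>If the mixed term vanished, the whole plane of \<open>x1\<close> and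
    \<open>x2\<close> would be isotropic for \<open>A1\<close>, while \<open>A2\<close> changes sign
    on the segment between them. The segment avoids zero since opposite \<open>A2\<close>-signs rule
    out proportional vectors.\<close>
  have cross: "x1 \<bullet> (A1 *v x2) \<noteq> 0"
  proof
    assume 0: "x1 \<bullet> (A1 *v x2) = 0"
    define g where "g t = (1 - t) *\<^sub>R x1 + t *\<^sub>R x2" for t :: real
    have "x2 \<bullet> (A1 *v x1) = 0" using 0 symmetric_matrix_swap[OF sym(2), of x1 x2] by simp
    then have iso: "quad_form A1 (s *\<^sub>R x1 + t *\<^sub>R x2) = 0" for s t
      using 0 A1 by (simp add: quad_form_combination)
    have "\<exists>z\<in>N. z \<noteq> 0 \<and> quad_form A1 z = 0 \<and> quad_form A2 z = 0"
    proof (rule common_isotropic_on_path[of g])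
      show "continuous_on {0..1} g" unfolding g_def by (intro continuous_intros)
      show "quad_form A2 (g 0) < 0" "0 < quad_form A2 (g 1)" using A2 by (simp_all add: g_def)
      show "g t \<in> N" for t unfolding g_def using N xN by (intro subspace_add subspace_scale)
      show "quad_form A1 (g t) = 0" for t unfolding g_def by (rule iso)
      show "g t \<noteq> 0" if "t \<in> {0..1}" for t
      proof
        assume "g t = 0"
        then have "(1 - t) *\<^sub>R x1 = (- t) *\<^sub>R x2" by (simp add: g_def eq_neg_iff_add_eq_0)
        then have "quad_form A2 ((1 - t) *\<^sub>R x1) = quad_form A2 ((- t) *\<^sub>R x2)" by simp
        then have eq: "(1 - t)\<^sup>2 * quad_form A2 x1 = t\<^sup>2 * quad_form A2 x2"
          unfolding quad_form_scaleR by simp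
        have "(1 - t)\<^sup>2 * quad_form A2 x1 \<le> 0" "0 \<le> t\<^sup>2 * quad_form A2 x2"
          using A2 by (simp_all add: mult_nonneg_nonpos)
        with eq have "(1 - t)\<^sup>2 * quad_form A2 x1 = 0" "t\<^sup>2 * quad_form A2 x2 = 0" by linarith+
        then show False using A2 by auto
      qed
    qed
    then show False using no_common by blast
  qed
  have "N = span {x1, x2}"
    using no_common_isotropic_imp_span[OF sym(2) N xN A1 cross A2] no_common by blast
  then show ?thesis
    unfolding Property_IR_def Let_def
    using psd \<mu> \<open>v < 0\<close> \<open>\<mu>1 \<noteq> 0\<close> \<open>\<mu>2 \<noteq> 0\<close> A1 A2 cross
    by (intro exI[of _ \<mu>1] exI[of _ \<mu>2] exI[of _ "- v"] exI[of _ x1] exI[of _ x2])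
      (simp add: Z_def N_def)
qed

section \<open>Multipliers exclude Property IR, and the equivalence\<close>

lemma not_Property_IR_of_multipliers:
  assumes "0 \<le> \<mu>1" "0 \<le> \<mu>2" and psd: "pos_semidef (A0 + \<mu>1 *\<^sub>R A1 + \<mu>2 *\<^sub>R A2)"
  shows "\<not> Property_IR A0 A1 A2"
proof
  assume "Property_IR A0 A1 A2"
  then obtain \<nu>1 \<nu>2 \<nu>3 x1 x2 where "0 < \<nu>3"
    and ker: "{x. (A0 + \<nu>1 *\<^sub>R A1 + \<nu>2 *\<^sub>R A2 + \<nu>3 *\<^sub>R mat 1) *v x = 0} = span {x1, x2}"
    and A1: "quad_form A1 x1 = 0" "quad_form A1 x2 = 0"
    and A2: "quad_form A2 x1 < 0" "0 < quad_form A2 x2"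
    unfolding Property_IR_def Let_def by blast
  let ?Z = "A0 + \<nu>1 *\<^sub>R A1 + \<nu>2 *\<^sub>R A2 + \<nu>3 *\<^sub>R mat 1"
  have Z: "quad_form A0 x + \<nu>1 * quad_form A1 x + \<nu>2 * quad_form A2 x + \<nu>3 * (norm x)\<^sup>2 = 0"
    if "x \<in> {x1, x2}" for x
  proof -
    have "?Z *v x = 0" using that span_base[OF that] ker by blast
    then have "quad_form ?Z x = 0" by simp
    then show ?thesis unfolding quad_form_matrix_add quad_form_matrix_scaleR quad_form_mat_1 .
  qed
  have M: "0 \<le> quad_form A0 x + \<mu>1 * quad_form A1 x + \<mu>2 * quad_form A2 x" for x
    using psd unfolding pos_semidef_def quad_form_pencil by blast
  \<comment> \<open>Weighting \<open>x1\<close> by \<open>a\<close> and \<open>x2\<close> by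
    \<open>d\<close> cancels the \<open>A2\<close>-terms, and \<open>A1\<close> vanishes at both.
    The weighted sum of \<open>A0\<close> is then nonnegative by \<open>psd\<close>, yet the kernel
    of \<open>?Z\<close> makes it \<open>- \<nu>3\<close> times a positive number.\<close>
  define a where "a = quad_form A2 x2"
  define d where "d = - quad_form A2 x1"
  have "a > 0" "d > 0" using A2 by (simp_all add: a_def d_def)
  have "x1 \<noteq> 0" using A2 by auto
  have "0 \<le> quad_form A0 x1 - \<mu>2 * d" "0 \<le> quad_form A0 x2 + \<mu>2 * a"
    using M[of x1] M[of x2] A1 by (simp_all add: a_def d_def)
  then have "0 \<le> a * (quad_form A0 x1 - \<mu>2 * d)" "0 \<le> d * (quad_form A0 x2 + \<mu>2 * a)"
    using \<open>a > 0\<close> \<open>d > 0\<close> by simp_all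
  moreover have "quad_form A0 x1 = \<nu>2 * d - \<nu>3 * (norm x1)\<^sup>2" "quad_form A0 x2 = - \<nu>2 * a - \<nu>3 * (norm x2)\<^sup>2"
    using Z[of x1] Z[of x2] A1 by (simp_all add: a_def d_def)
  ultimately have "\<nu>3 * (a * (norm x1)\<^sup>2 + d * (norm x2)\<^sup>2) \<le> 0"
    by (simp add: algebra_simps)
  moreover have "0 < a * (norm x1)\<^sup>2 + d * (norm x2)\<^sup>2"
    using \<open>a > 0\<close> \<open>d > 0\<close> \<open>x1 \<noteq> 0\<close> by (simp add: add_pos_nonneg)
  ultimately show False using \<open>0 < \<nu>3\<close> by (simp add: mult_le_0_iff)
qed

theorem theorem4p2:
  fixes A0 A1 A2 :: "real^'n^'n"
  assumes "symmetric_matrix A0" and "symmetric_matrix A1" and "symmetric_matrix A2"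
    and "\<exists>x0::real^'n. x0 \<bullet> (A1 *v x0) < 0 \<and> x0 \<bullet> (A2 *v x0) < 0"
  shows "(\<not> (\<exists>x::real^'n. x \<bullet> (A0 *v x) < 0 \<and> x \<bullet> (A1 *v x) \<le> 0 \<and> x \<bullet> (A2 *v x) \<le> 0)
            \<and> \<not> Property_IR A0 A1 A2)
         \<longleftrightarrow>
         (\<exists>(\<mu>1::real) (\<mu>2::real). 0 \<le> \<mu>1 \<and> 0 \<le> \<mu>2 \<and>
            pos_semidef (A0 + \<mu>1 *\<^sub>R A1 + \<mu>2 *\<^sub>R A2))"
  (is "?i \<longleftrightarrow> ?ii")
proof
  assume ?i
  obtain x0 where x0: "quad_form A1 x0 < 0" "quad_form A2 x0 < 0" using assms(4) by blast
  obtain \<mu>1 \<mu>2 v xs where \<mu>: "0 \<le> \<mu>1" "0 \<le> \<mu>2"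
    and lb: "\<And>x. v * (norm x)\<^sup>2 \<le> quad_form A0 x + \<mu>1 * quad_form A1 x + \<mu>2 * quad_form A2 x"
    and xs: "(\<Sum>x\<leftarrow>xs. quad_form A0 x) = v" "(\<Sum>x\<leftarrow>xs. quad_form A1 x) \<le> 0"
    "(\<Sum>x\<leftarrow>xs. quad_form A2 x) \<le> 0" "(\<Sum>x\<leftarrow>xs. quad_form (mat 1) x) = 1"
    by (rule trace_one_strong_duality[OF x0, of A0]) (erule that; assumption)
  have "0 \<le> v"
  proof (rule ccontr)
    assume "\<not> 0 \<le> v"
    then have "Property_IR A0 A1 A2"
      using \<open>?i\<close>
      by (intro Property_IR_of_negative_value[OF assms(1-3) \<mu> _ lb xs]) (auto simp: not_less)
    then show False using \<open>?i\<close> by blast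
  qed
  have "0 \<le> quad_form (A0 + \<mu>1 *\<^sub>R A1 + \<mu>2 *\<^sub>R A2) x" for x
    unfolding quad_form_pencil
    using lb[of x] mult_nonneg_nonneg[OF \<open>0 \<le> v\<close> zero_le_power2, of "norm x"]
    by linarith
  then show ?ii
    using \<mu> assms(1-3) unfolding pos_semidef_def
    by (intro exI[of _ \<mu>1] exI[of _ \<mu>2]) (simp add: symmetric_matrix_add symmetric_matrix_scaleR)
next
  assume ?ii
  then obtain \<mu>1 \<mu>2 where \<mu>: "0 \<le> \<mu>1" "0 \<le> \<mu>2" and psd: "pos_semidef (A0 + \<mu>1 *\<^sub>R A1 + \<mu>2 *\<^sub>R A2)"
    by blast
  have "0 \<le> quad_form A0 x" if "quad_form A1 x \<le> 0" "quad_form A2 x \<le> 0" for x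
  proof -
    have "0 \<le> quad_form A0 x + \<mu>1 * quad_form A1 x + \<mu>2 * quad_form A2 x"
      using psd unfolding pos_semidef_def quad_form_pencil by blast
    then show ?thesis
      using mult_nonneg_nonpos[OF \<mu>(1) that(1)] mult_nonneg_nonpos[OF \<mu>(2) that(2)] by linarith
  qed
  then show ?i
    using not_Property_IR_of_multipliers[OF \<mu> psd] by (auto simp: not_less)
qed

end
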